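(* Let $X$ be the union of two circles $S_0$ and $S_1$, each of circumference $4$, intersecting in (exactly) a pair of points antipodal in each, with the arc-length metric. Then for any nonzero real normed vector space $V$, $\mathrm{map\text{-}rad}(X,V)=1$.
   Context: The arc-length metric on $X$ is the path metric: the distance between two points is the length of a shortest path in $X$ joining them. A map $f:X\to Y$ of metric spaces is nonexpansive if $d(f(x_0),f(x_1))\le d(x_0,x_1)$ for all $x_0,x_1\in X$; $\mathbf{Metr}(X,Y)$ denotes the set of nonexpansive maps $X\to Y$. For a nonempty subset $A$ of a metric space $Y$, $\mathrm{rad}_Y(A)=\inf_{y\in Y}\sup_{a\in A} d(a,y)\in[0,+\infty]$. For metric spaces $X,Y$, $\mathrm{map\text{-}rad}(X,Y)=\sup_{f\in\mathbf{Metr}(X,Y)}\mathrm{rad}_Y(f(X))$. Normed vector spaces are regarded as metric spaces via the metric induced by the norm. *)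

theory Defs
  imports "HOL-Analysis.Analysis"
begin

text \<open>A round circle with centre \<open>c\<close> and radius \<open>r\<close>, lying in some affine plane through \<open>c\<close>
  of a Euclidean space of arbitrary dimension.\<close>

definition is_circle :: "'a::euclidean_space \<Rightarrow> real \<Rightarrow> 'a set \<Rightarrow> bool" where
  "is_circle c r S \<longleftrightarrow>
     r > 0 \<and> (\<exists>P. affine P \<and> aff_dim P = 2 \<and> c \<in> P \<and> S = P \<inter> sphere c r)"

text \<open>The sample points \<open>t 0 \<le> t 1 \<le> \<dots>\<close> of a subdivision need not be distinct and need not
  include \<open>0\<close> and \<open>1\<close>; this does not affect the supremum.\<close>

definition path_length :: "(real \<Rightarrow> 'a::metric_space) \<Rightarrow> ennreal" where
  "path_length g =
     (SUP t \<in> {t :: nat \<Rightarrow> real. mono t \<and> range t \<subseteq> {0..1}}.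
        SUP n. \<Sum>i<n. ennreal (dist (g (t i)) (g (t (Suc i)))))"

text \<open>The shortest-path distance within \<open>X\<close>. It is a real-valued metric only when any two points
  of \<open>X\<close> are joined by a path of finite length in \<open>X\<close> (otherwise \<open>enn2real\<close> sends
  infinity to \<open>0\<close>).\<close>

definition arc_dist :: "'a::metric_space set \<Rightarrow> 'a \<Rightarrow> 'a \<Rightarrow> real" where
  "arc_dist X x y =
     enn2real (INF g \<in> {g. path g \<and> path_image g \<subseteq> X \<and> pathstart g = x \<and> pathfinish g = y}.
                 path_length g)"

definition arc_length_metric :: "'a::metric_space set \<Rightarrow> 'a metric" where
  "arc_length_metric X = metric (X, arc_dist X)"

text \<open>Maps are total functions in HOL; values outside \<open>mspace X\<close> are irrelevant below.\<close>

definition Metr :: "'a metric \<Rightarrow> 'b metric \<Rightarrow> ('a \<Rightarrow> 'b) set" where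
  "Metr X Y = {f. f \<in> mspace X \<rightarrow> mspace Y \<and>
     (\<forall>x0\<in>mspace X. \<forall>x1\<in>mspace X. mdist Y (f x0) (f x1) \<le> mdist X x0 x1)}"

definition rad :: "'b metric \<Rightarrow> 'b set \<Rightarrow> ennreal" where
  "rad Y A = (INF y \<in> mspace Y. SUP a \<in> A. ennreal (mdist Y a y))"

definition map_rad :: "'a metric \<Rightarrow> 'b metric \<Rightarrow> ennreal" where
  "map_rad X Y = (SUP f \<in> Metr X Y. rad Y (f ` mspace X))"

end

theory Submission
  imports Defs
begin

text \<open>Every point of \<open>X\<close> lies on an arc of length \<open>2\<close> from \<open>p\<close> to \<open>q\<close>, so for a nonexpansive \<open>f\<close> the
  midpoint of \<open>f p\<close> and \<open>f q\<close> is within \<open>1\<close> of all of \<open>f ` X\<close>. Conversely, \<open>f x = (r * h x) *\<^sub>R v\<close>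
  with \<open>h x\<close> the angle between \<open>x - c\<close> and \<open>p - c\<close> and \<open>norm v = 1\<close> satisfies \<open>f p = 0\<close> and
  \<open>f q = 2 *\<^sub>R v\<close>, so its image has radius at least \<open>1\<close>. It is nonexpansive because on the sphere
  of radius \<open>r\<close> a change of \<open>h\<close> by \<open>\<delta>\<close> forces a chord of length at least \<open>2 * r * sin (\<delta> / 2)\<close>,
  which is asymptotic to \<open>r * \<delta>\<close> under subdivision of a path.\<close>

section \<open>Subdivisions of the unit interval and path length\<close>

definition admissible :: "(nat \<Rightarrow> real) \<Rightarrow> bool" where
  "admissible t \<longleftrightarrow> mono t \<and> range t \<subseteq> {0..1}"

lemma path_length_le_iff:
  "path_length g \<le> B \<longleftrightarrow>
     (\<forall>t n. admissible t \<longrightarrow> (\<Sum>i<n. ennreal (dist (g (t i)) (g (t (Suc i))))) \<le> B)"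
  unfolding path_length_def admissible_def SUP_le_iff by auto

lemma sum_le_path_length:
  assumes "admissible t"
  shows "(\<Sum>i<n. ennreal (dist (g (t i)) (g (t (Suc i))))) \<le> path_length g"
  using path_length_le_iff[of g "path_length g"] assms by blast

lemma admissibleD:
  assumes "admissible t"
  shows "0 \<le> t i" "t i \<le> 1" "t i \<le> t (Suc i)"
  using assms by (auto simp: admissible_def mono_def image_subset_iff)

lemma admissibleI:
  assumes "\<And>i. t i \<le> t (Suc i)" "\<And>i. 0 \<le> t i" "\<And>i. t i \<le> 1"
  shows "admissible t"
  using assms by (auto simp: admissible_def mono_iff_le_Suc)

lemma path_length_Lipschitz:
  assumes "\<And>s t. s \<in> {0..1} \<Longrightarrow> t \<in> {0..1} \<Longrightarrow> dist (g s) (g t) \<le> L * \<bar>s - t\<bar>" and "L \<ge> 0"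
  shows "path_length g \<le> ennreal L"
  unfolding path_length_le_iff
proof (intro allI impI)
  fix t :: "nat \<Rightarrow> real" and n assume t: "admissible t"
  have "(\<Sum>i<n. dist (g (t i)) (g (t (Suc i)))) \<le> (\<Sum>i<n. L * (t (Suc i) - t i))"
  proof (rule sum_mono)
    fix i
    show "dist (g (t i)) (g (t (Suc i))) \<le> L * (t (Suc i) - t i)"
      using assms(1)[of "t i" "t (Suc i)"] admissibleD[OF t, of i] admissibleD[OF t, of "Suc i"]
      by (simp add: abs_if split: if_splits)
  qed
  also have "\<dots> = L * (t n - t 0)"
    by (simp add: sum_distrib_left[symmetric] sum_lessThan_telescope)
  also have "\<dots> \<le> L * 1"
    using admissibleD[OF t, of n] admissibleD[OF t, of 0] assms(2)
    by (intro mult_left_mono) auto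
  finally show "(\<Sum>i<n. ennreal (dist (g (t i)) (g (t (Suc i))))) \<le> ennreal L"
    by (simp add: sum_ennreal ennreal_leI)
qed

lemma dist_le_path_length:
  "ennreal (dist (pathstart g) (pathfinish g)) \<le> path_length g"
proof -
  \<comment> \<open>The coarsest subdivision \<open>0, 1, 1, ...\<close> has the chord between the
    endpoints as its only nonzero term.\<close>
  have "admissible (\<lambda>i. if i = 0 then 0 else 1)"
    by (rule admissibleI) auto
  from sum_le_path_length[OF this, where n = 1 and g = g] show ?thesis
    by (simp add: pathstart_def pathfinish_def)
qed

lemma path_length_reversepath_le: "path_length (reversepath g) \<le> path_length g"
  unfolding path_length_le_iff
proof (intro allI impI)
  fix t :: "nat \<Rightarrow> real" and n assume t: "admissible t"
  \<comment> \<open>The first \<open>n + 1\<close> sample points in reverse order. Truncated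
    subtraction keeps \<open>s\<close> constant from index \<open>n\<close> on, so it stays
    monotone.\<close>
  define s where "s j = 1 - t (n - j)" for j
  have s: "admissible s"
  proof (rule admissibleI)
    show "s i \<le> s (Suc i)" for i
      using t by (auto simp: s_def admissible_def mono_def)
  qed (use admissibleD[OF t] in \<open>auto simp: s_def\<close>)
  have "(\<Sum>i<n. ennreal (dist (reversepath g (t i)) (reversepath g (t (Suc i)))))
      = (\<Sum>i<n. ennreal (dist (reversepath g (t (n - Suc i))) (reversepath g (t (Suc (n - Suc i))))))"
    by (rule sum.nat_diff_reindex[symmetric])
  also have "\<dots> = (\<Sum>i<n. ennreal (dist (g (s i)) (g (s (Suc i)))))"
    by (intro sum.cong refl) (simp add: reversepath_def s_def dist_commute Suc_diff_Suc)
  also have "\<dots> \<le> path_length g"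
    using s by (rule sum_le_path_length)
  finally show "(\<Sum>i<n. ennreal (dist (reversepath g (t i)) (reversepath g (t (Suc i))))) \<le> path_length g" .
qed

text \<open>Clamping a subdivision to \<open>[0, 1/2]\<close> and to \<open>[1/2, 1]\<close> avoids locating the index at which it
  crosses \<open>1/2\<close>.\<close>

lemma path_length_join_le:
  assumes "pathfinish g = pathstart h"
  shows "path_length (g +++ h) \<le> path_length g + path_length h"
  unfolding path_length_le_iff
proof (intro allI impI)
  fix t :: "nat \<Rightarrow> real" and n assume t: "admissible t"
  define a where "a i = min 1 (2 * t i)" for i
  define b where "b i = max 0 (2 * t i - 1)" for i
  have a: "admissible a"
    by (rule admissibleI) (use admissibleD[OF t] in \<open>auto simp: a_def min_def intro: order_trans\<close>)
  have b: "admissible b"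
    by (rule admissibleI) (use admissibleD[OF t] in \<open>auto simp: b_def max_def intro: order_trans\<close>)
  have gh: "g 1 = h 0"
    using assms by (simp add: pathfinish_def pathstart_def)
  have "dist ((g +++ h) (t i)) ((g +++ h) (t (Suc i)))
        \<le> dist (g (a i)) (g (a (Suc i))) + dist (h (b i)) (h (b (Suc i)))" for i
  proof -
    consider "t (Suc i) \<le> 1/2" | "t i \<le> 1/2" "t (Suc i) > 1/2" | "t i > 1/2"
      by linarith
    then show ?thesis
    proof cases
      case 1
      then show ?thesis
        using admissibleD(3)[OF t, of i] by (simp add: joinpaths_def a_def b_def)
    next
      \<comment> \<open>The step that crosses \<open>1/2\<close> is broken at the common point
        \<open>g 1 = h 0\<close>; in the other two cases one of the clamped sequences stands
        still.\<close>
      case 2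
      then have "a i = 2 * t i" "b i = 0" "a (Suc i) = 1" "b (Suc i) = 2 * t (Suc i) - 1"
        by (auto simp: a_def b_def)
      then show ?thesis
        using 2 gh dist_triangle[of "g (a i)" "h (b (Suc i))" "h 0"] by (simp add: joinpaths_def)
    next
      case 3
      then have "t (Suc i) > 1/2"
        using admissibleD(3)[OF t, of i] by linarith
      then show ?thesis
        using 3 by (simp add: joinpaths_def a_def b_def)
    qed
  qed
  then have "(\<Sum>i<n. ennreal (dist ((g +++ h) (t i)) ((g +++ h) (t (Suc i)))))
      \<le> (\<Sum>i<n. ennreal (dist (g (a i)) (g (a (Suc i)))) + ennreal (dist (h (b i)) (h (b (Suc i)))))"
    by (intro sum_mono) (simp add: ennreal_leI flip: ennreal_plus)
  also have "\<dots> \<le> path_length g + path_length h"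
    unfolding sum.distrib by (intro add_mono sum_le_path_length a b)
  finally show "(\<Sum>i<n. ennreal (dist ((g +++ h) (t i)) ((g +++ h) (t (Suc i)))))
      \<le> path_length g + path_length h" .
qed

section \<open>Arc distance as a metric\<close>

definition paths_between :: "'a::metric_space set \<Rightarrow> 'a \<Rightarrow> 'a \<Rightarrow> (real \<Rightarrow> 'a) set" where
  "paths_between X x y = {g. path g \<and> path_image g \<subseteq> X \<and> pathstart g = x \<and> pathfinish g = y}"

text \<open>This is the condition under which \<open>enn2real\<close> in \<open>arc_dist\<close>
  never meets the value infinity.\<close>

definition rectifiably_connected :: "'a::metric_space set \<Rightarrow> bool" where
  "rectifiably_connected X \<longleftrightarrow>
     (\<forall>x\<in>X. \<forall>y\<in>X. \<exists>g\<in>paths_between X x y. path_length g < \<infinity>)"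

lemma reversepath_in_paths_between:
  "g \<in> paths_between X x y \<Longrightarrow> reversepath g \<in> paths_between X y x"
  by (auto simp: paths_between_def)

lemma join_in_paths_between:
  "g \<in> paths_between X x y \<Longrightarrow> h \<in> paths_between X y z \<Longrightarrow> g +++ h \<in> paths_between X x z"
  by (auto simp: paths_between_def path_image_join)

lemma arc_dist_le:
  assumes "g \<in> paths_between X x y" "path_length g \<le> ennreal L" "L \<ge> 0"
  shows "arc_dist X x y \<le> L"
proof -
  have "(INF g\<in>paths_between X x y. path_length g) \<le> ennreal L"
    using assms by (meson INF_lower order_trans)
  then show ?thesis
    unfolding arc_dist_def paths_between_def using assms(3) by (intro enn2real_leI) auto
qed

lemma ennreal_arc_dist:
  assumes "rectifiably_connected X" "x \<in> X" "y \<in> X"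
  shows "ennreal (arc_dist X x y) = (INF g\<in>paths_between X x y. path_length g)"
proof -
  obtain g where "g \<in> paths_between X x y" "path_length g < \<infinity>"
    using assms by (auto simp: rectifiably_connected_def)
  then have "(INF g\<in>paths_between X x y. path_length g) < top"
    by (metis INF_lower infinity_ennreal_def le_less_trans)
  then show ?thesis
    unfolding arc_dist_def paths_between_def by simp
qed

lemma arc_dist_ge:
  assumes "rectifiably_connected X" "x \<in> X" "y \<in> X"
    and "\<And>g. g \<in> paths_between X x y \<Longrightarrow> ennreal L \<le> path_length g"
  shows "L \<le> arc_dist X x y"
proof -
  have "ennreal L \<le> ennreal (arc_dist X x y)"
    unfolding ennreal_arc_dist[OF assms(1-3)] by (intro INF_greatest assms(4))
  then show ?thesis
    by (simp add: ennreal_le_iff arc_dist_def)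
qed

text \<open>The infimum is not known to be attained, so the metric axioms are proved with paths
  whose length exceeds it by at most \<open>e\<close>.\<close>

lemma arc_dist_approx:
  assumes "rectifiably_connected X" "x \<in> X" "y \<in> X" "e > 0"
  obtains g where "g \<in> paths_between X x y" "path_length g \<le> ennreal (arc_dist X x y + e)"
proof -
  have "(INF g\<in>paths_between X x y. path_length g) < ennreal (arc_dist X x y + e)"
    unfolding ennreal_arc_dist[OF assms(1-3), symmetric]
    using assms(4) by (intro ennreal_lessI) (auto simp: arc_dist_def add_nonneg_pos)
  then show thesis
    using that unfolding INF_less_iff by (blast intro: less_imp_le)
qed

text \<open>The type \<open>metric\<close> is abstract: carrier and distance can be read off
  \<open>arc_length_metric X\<close> only once the axioms hold. Reversal gives symmetry and
  concatenation the triangle inequality.\<close>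

lemma Metric_space_arc_dist:
  assumes X: "rectifiably_connected X"
  shows "Metric_space X (arc_dist X)"
proof
  show nonneg: "0 \<le> arc_dist X x y" for x y
    by (simp add: arc_dist_def)
  have le: "arc_dist X x y \<le> arc_dist X y x" if xy: "x \<in> X" "y \<in> X" for x y
  proof (rule field_le_epsilon)
    fix e :: real assume e: "e > 0"
    obtain g where "g \<in> paths_between X y x" "path_length g \<le> ennreal (arc_dist X y x + e)"
      using arc_dist_approx[OF X xy(2,1) e] .
    then show "arc_dist X x y \<le> arc_dist X y x + e"
      using path_length_reversepath_le[of g] nonneg[of y x] e
      by (intro arc_dist_le[OF reversepath_in_paths_between]) auto
  qed
  \<comment> \<open>The locale demands symmetry for all arguments. Outside \<open>X\<close> there
    are no paths, the infimum over the empty set is infinite, and \<open>enn2real\<close> turns it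
    into \<open>0\<close>.\<close>
  have out: "arc_dist X x y = 0" if "x \<notin> X \<or> y \<notin> X" for x y
  proof -
    have "paths_between X x y = {}"
      using that by (auto simp: paths_between_def)
    then show ?thesis
      unfolding arc_dist_def paths_between_def[symmetric] by simp
  qed
  show "arc_dist X x y = arc_dist X y x" for x y
    using le out by (metis order_antisym)
  show "arc_dist X x y = 0 \<longleftrightarrow> x = y" if xy: "x \<in> X" "y \<in> X" for x y
  proof
    assume "arc_dist X x y = 0"
    moreover have "dist x y \<le> arc_dist X x y"
      using dist_le_path_length
      by (intro arc_dist_ge[OF X xy]) (auto simp: paths_between_def)
    ultimately show "x = y" by simp
  next
    assume [simp]: "x = y"
    have "(\<lambda>_. x) \<in> paths_between X x x"
      using xy by (auto simp: paths_between_def path_def path_image_def pathstart_def pathfinish_def)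
    then have "arc_dist X x x \<le> 0"
      using path_length_Lipschitz[of "\<lambda>_. x" 0] by (intro arc_dist_le) auto
    then show "arc_dist X x y = 0"
      using nonneg[of x x] by simp
  qed
  show "arc_dist X x z \<le> arc_dist X x y + arc_dist X y z" if xyz: "x \<in> X" "y \<in> X" "z \<in> X" for x y z
  proof (rule field_le_epsilon)
    fix e :: real assume "e > 0"
    then have e: "e / 2 > 0" by simp
    obtain g where g: "g \<in> paths_between X x y" "path_length g \<le> ennreal (arc_dist X x y + e/2)"
      using arc_dist_approx[OF X xyz(1,2) e] .
    obtain h where h: "h \<in> paths_between X y z" "path_length h \<le> ennreal (arc_dist X y z + e/2)"
      using arc_dist_approx[OF X xyz(2,3) e] .
    have "path_length (g +++ h) \<le> path_length g + path_length h"
      using g h by (intro path_length_join_le) (auto simp: paths_between_def)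
    also have "\<dots> \<le> ennreal (arc_dist X x y + e/2) + ennreal (arc_dist X y z + e/2)"
      using g h by (intro add_mono)
    also have "\<dots> = ennreal (arc_dist X x y + arc_dist X y z + e)"
      using nonneg[of x y] nonneg[of y z] e by (simp flip: ennreal_plus)
    finally show "arc_dist X x z \<le> arc_dist X x y + arc_dist X y z + e"
      using nonneg[of x y] nonneg[of y z] e
      by (intro arc_dist_le[OF join_in_paths_between[OF g(1) h(1)]]) auto
  qed
qed

section \<open>Lower bounds for the length of paths on a sphere\<close>

text \<open>The derivative of \<open>sin\<close> at \<open>0\<close> is \<open>1\<close>, so a short
  chord of the unit circle nearly equals its arc.\<close>

lemma two_sin_half_lower_bound:
  assumes "e > (0::real)"
  obtains d where "d > 0" "\<And>x. 0 \<le> x \<Longrightarrow> x < d \<Longrightarrow> (1 - e) * x \<le> 2 * sin (x / 2)"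
proof -
  have "((\<lambda>x::real. sin x) has_real_derivative cos 0) (at 0)"
    by (rule DERIV_sin)
  then have "((\<lambda>x::real. sin x / x) \<longlongrightarrow> 1) (at 0)"
    by (simp add: has_field_derivative_iff)
  then have "eventually (\<lambda>x::real. sin x / x > 1 - e) (at 0)"
    by (rule order_tendstoD) (use assms in auto)
  then obtain d where d: "d > 0" "\<And>x::real. x \<noteq> 0 \<Longrightarrow> \<bar>x\<bar> < d \<Longrightarrow> sin x / x > 1 - e"
    unfolding eventually_at dist_real_def by auto
  show thesis
  \<comment> \<open>The bound is doubled because the sine is taken at \<open>x / 2\<close>.\<close>
  proof (rule that[of "2 * d"])
    show "(1 - e) * x \<le> 2 * sin (x / 2)" if "0 \<le> x" "x < 2 * d" for x
    proof (cases "x = 0")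
      case False
      then show ?thesis
        using d(2)[of "x / 2"] that by (simp add: field_simps)
    qed auto
  qed (use d in auto)
qed

text \<open>A single chord loses length against the arc. Uniform continuity yields a subdivision on
  which every increment of \<open>h\<close> is so small that the loss is a factor of at most
  \<open>1 - e\<close>; the increments telescope, and \<open>e\<close> tends to
  \<open>0\<close>.\<close>

lemma path_length_lower_bound:
  fixes g :: "real \<Rightarrow> 'a::metric_space" and h :: "'a \<Rightarrow> real"
  assumes cont: "continuous_on {0..1} (h \<circ> g)" and r: "r > 0"
    and sep: "\<And>s t. s \<in> {0..1} \<Longrightarrow> t \<in> {0..1} \<Longrightarrow> 2 * r * sin (\<bar>h (g s) - h (g t)\<bar> / 2) \<le> dist (g s) (g t)"
  shows "ennreal (r * \<bar>h (g 0) - h (g 1)\<bar>) \<le> path_length g"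
proof (cases "path_length g")
  case (real l)
  have "r * \<bar>h (g 0) - h (g 1)\<bar> * (1 - e) \<le> l" if e: "e > 0" for e :: real
  proof -
    obtain d where d: "d > 0" "\<And>x. 0 \<le> x \<Longrightarrow> x < d \<Longrightarrow> (1 - e) * x \<le> 2 * sin (x / 2)"
      using two_sin_half_lower_bound[OF e] by blast
    have "uniformly_continuous_on {0..1} (h \<circ> g)"
      using cont by (intro compact_uniformly_continuous) auto
    then obtain k where k: "k > 0"
      "\<And>s t. s \<in> {0..1} \<Longrightarrow> t \<in> {0..1} \<Longrightarrow> dist s t < k \<Longrightarrow> dist (h (g s)) (h (g t)) < d"
      unfolding uniformly_continuous_on_def using d(1) by (metis comp_apply)
    obtain n where n: "n > 0" "1 / real n < k"
      using nat_approx_posE[OF k(1)] by (metis zero_less_Suc)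
    \<comment> \<open>There are \<open>n\<close> equal steps, each shorter than \<open>k\<close>;
      the minimum keeps the infinite sequence at \<open>1\<close> afterwards.\<close>
    define t where "t i = min 1 (real i / real n)" for i
    have t: "admissible t"
      by (rule admissibleI) (use n in \<open>auto simp: t_def min_def field_simps\<close>)
    have step: "dist (t i) (t (Suc i)) < k" for i
    proof -
      have "\<bar>t i - t (Suc i)\<bar> \<le> 1 / real n"
      proof -
        have *: "real (Suc i) / real n = real i / real n + 1 / real n" and "1 / real n \<ge> 0"
          by (simp_all add: add_divide_distrib)
        then show ?thesis
          unfolding t_def * by linarith
      qed
      then show ?thesis using n(2) by (simp add: dist_real_def)
    qed
    have "(1 - e) * (r * \<bar>h (g (t i)) - h (g (t (Suc i)))\<bar>) \<le> dist (g (t i)) (g (t (Suc i)))" for i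
    proof -
      have I: "t i \<in> {0..1}" "t (Suc i) \<in> {0..1}"
        using admissibleD[OF t] by auto
      have "(1 - e) * \<bar>h (g (t i)) - h (g (t (Suc i)))\<bar> \<le> 2 * sin (\<bar>h (g (t i)) - h (g (t (Suc i)))\<bar> / 2)"
        using k(2)[OF I step] by (intro d) (auto simp: dist_real_def)
      from mult_left_mono[OF this, of r] sep[OF I] r show ?thesis
        by (simp add: algebra_simps)
    qed
    then have "(\<Sum>i<n. (1 - e) * (r * \<bar>h (g (t i)) - h (g (t (Suc i)))\<bar>)) \<le> (\<Sum>i<n. dist (g (t i)) (g (t (Suc i))))"
      by (intro sum_mono)
    also have "\<dots> \<le> l"
      using sum_le_path_length[OF t, where n = n and g = g] real by (simp add: sum_nonneg)
    finally have *: "(1 - e) * (r * (\<Sum>i<n. \<bar>h (g (t i)) - h (g (t (Suc i)))\<bar>)) \<le> l"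
      by (simp add: sum_distrib_left)
    show ?thesis
    \<comment> \<open>Multiplying by \<open>1 - e\<close> preserves the inequality only if this
      factor is nonnegative; otherwise the left side is at most \<open>0\<close>.\<close>
    proof (cases "e \<le> 1")
      case True
      have "\<bar>h (g (t 0)) - h (g (t n))\<bar> = \<bar>\<Sum>i<n. h (g (t i)) - h (g (t (Suc i)))\<bar>"
        by (simp add: sum_lessThan_telescope'[of "\<lambda>i. h (g (t i))"])
      also have "\<dots> \<le> (\<Sum>i<n. \<bar>h (g (t i)) - h (g (t (Suc i)))\<bar>)"
        by (rule sum_abs)
      finally have "\<bar>h (g 0) - h (g 1)\<bar> \<le> (\<Sum>i<n. \<bar>h (g (t i)) - h (g (t (Suc i)))\<bar>)"
        using n(1) by (simp add: t_def)
      then have "(1 - e) * (r * \<bar>h (g 0) - h (g 1)\<bar>) \<le> (1 - e) * (r * (\<Sum>i<n. \<bar>h (g (t i)) - h (g (t (Suc i)))\<bar>))"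
        using r True by (intro mult_left_mono) auto
      with * show ?thesis by (simp add: algebra_simps)
    next
      case False
      then have "r * \<bar>h (g 0) - h (g 1)\<bar> * (1 - e) \<le> 0"
        using r by (intro mult_nonneg_nonpos) auto
      then show ?thesis using real by linarith
    qed
  qed
  note bound = this
  define z where "z = r * \<bar>h (g 0) - h (g 1)\<bar>"
  have z: "z \<ge> 0" using r by (simp add: z_def)
  have "z \<le> l"
  proof (rule field_le_epsilon)
    fix e :: real assume e: "e > 0"
    \<comment> \<open>With the relative error \<open>e / (z + 1)\<close> the absolute error stays
      below \<open>e\<close>; adding \<open>1\<close> covers \<open>z = 0\<close>.\<close>
    have "z * (1 - e / (z + 1)) \<le> l"
      unfolding z_def using bound e z by (simp add: z_def)
    moreover have "z * (e / (z + 1)) \<le> e"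
      using z e by (simp add: field_simps)
    ultimately show "z \<le> l + e" by (simp add: algebra_simps)
  qed
  then show ?thesis using real by (simp add: ennreal_leI z_def)
qed simp

text \<open>The triangle inequality for angles, in chord form. Cauchy-Schwarz for the components
  orthogonal to \<open>e\<close>, of lengths \<open>sin \<alpha>\<close> and
  \<open>sin \<beta>\<close>, gives
  \<open>a \<bullet> b \<le> cos (\<alpha> - \<beta>)\<close>.\<close>

lemma two_sin_half_arccos_diff_le:
  fixes a b e :: "'a::real_inner"
  assumes "norm a = 1" "norm b = 1" "norm e = 1"
  shows "2 * sin (\<bar>arccos (a \<bullet> e) - arccos (b \<bullet> e)\<bar> / 2) \<le> norm (a - b)"
proof -
  have ae: "\<bar>a \<bullet> e\<bar> \<le> 1" and be: "\<bar>b \<bullet> e\<bar> \<le> 1"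
    using Cauchy_Schwarz_ineq2[of a e] Cauchy_Schwarz_ineq2[of b e] assms by auto
  define \<alpha> \<beta> where "\<alpha> = arccos (a \<bullet> e)" and "\<beta> = arccos (b \<bullet> e)"
  define a' b' where "a' = a - (a \<bullet> e) *\<^sub>R e" and "b' = b - (b \<bullet> e) *\<^sub>R e"
  have 1: "a \<bullet> a = 1" "b \<bullet> b = 1" "e \<bullet> e = 1"
    using assms by (auto simp: dot_square_norm)
  have cs: "cos \<alpha> = a \<bullet> e" "cos \<beta> = b \<bullet> e"
    using ae be by (auto simp: \<alpha>_def \<beta>_def cos_arccos_abs)
  have sn: "sin \<alpha> = sqrt (1 - (a \<bullet> e)\<^sup>2)" "sin \<beta> = sqrt (1 - (b \<bullet> e)\<^sup>2)"
    using ae be by (auto simp: \<alpha>_def \<beta>_def sin_arccos_abs)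
  have "norm a' = sin \<alpha>" "norm b' = sin \<beta>"
    unfolding sn norm_eq_sqrt_inner a'_def b'_def
    by (auto simp: inner_diff 1 inner_commute power2_eq_square)
  moreover have "a' \<bullet> b' = a \<bullet> b - cos \<alpha> * cos \<beta>"
    unfolding a'_def b'_def cs by (simp add: inner_diff 1 inner_commute)
  ultimately have "a \<bullet> b \<le> cos (\<alpha> - \<beta>)"
    using norm_cauchy_schwarz[of a' b'] by (simp add: cos_diff)
  moreover have "cos (\<alpha> - \<beta>) = 1 - 2 * (sin (\<bar>\<alpha> - \<beta>\<bar> / 2))\<^sup>2"
    using cos_double_sin[of "\<bar>\<alpha> - \<beta>\<bar> / 2"] by simp
  moreover have "(norm (a - b))\<^sup>2 = 2 - 2 * (a \<bullet> b)"
    by (simp add: power2_norm_eq_inner inner_diff 1 inner_commute)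
  ultimately have "(2 * sin (\<bar>\<alpha> - \<beta>\<bar> / 2))\<^sup>2 \<le> (norm (a - b))\<^sup>2"
    by (simp add: power_mult_distrib)
  then show ?thesis
    unfolding \<alpha>_def \<beta>_def by (rule power2_le_imp_le) simp
qed

text \<open>The bound is stated on a whole sphere so that it covers paths that switch between the
  two circles.\<close>

lemma angle_path_length:
  fixes c p :: "'a::euclidean_space"
  assumes g: "path g" "path_image g \<subseteq> sphere c r" and p: "p \<in> sphere c r" and r: "r > 0"
  defines "h \<equiv> \<lambda>x. arccos (((x - c) /\<^sub>R r) \<bullet> ((p - c) /\<^sub>R r))"
  shows "ennreal (r * \<bar>h (pathstart g) - h (pathfinish g)\<bar>) \<le> path_length g"
  unfolding pathstart_def pathfinish_def
proof (rule path_length_lower_bound[OF _ r])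
  have nrm: "norm ((x - c) /\<^sub>R r) = 1" if "x \<in> sphere c r" for x
    using that r by (simp add: dist_norm norm_minus_commute)
  have S: "g s \<in> sphere c r" if "s \<in> {0..1}" for s
    using that g(2) unfolding path_image_def by blast
  show "2 * r * sin (\<bar>h (g s) - h (g t)\<bar> / 2) \<le> dist (g s) (g t)" if "s \<in> {0..1}" "t \<in> {0..1}" for s t
  proof -
    have "2 * sin (\<bar>h (g s) - h (g t)\<bar> / 2) \<le> norm ((g s - c) /\<^sub>R r - (g t - c) /\<^sub>R r)"
      unfolding h_def by (intro two_sin_half_arccos_diff_le nrm S that p)
    also have "\<dots> = norm (g s - g t) / r"
      using r by (simp flip: scaleR_diff_right add: divide_inverse_commute)
    finally show ?thesis
      using r by (simp add: dist_norm field_simps)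
  qed
  show "continuous_on {0..1} (h \<circ> g)"
    unfolding h_def comp_def
  proof (intro continuous_on_arccos continuous_intros ballI)
    show "continuous_on {0..1} g" using g(1) by (simp add: path_def)
    fix s :: real assume "s \<in> {0..1}"
    then have "\<bar>((g s - c) /\<^sub>R r) \<bullet> ((p - c) /\<^sub>R r)\<bar> \<le> 1"
      using Cauchy_Schwarz_ineq2[of "(g s - c) /\<^sub>R r" "(p - c) /\<^sub>R r"] nrm[OF S] nrm[OF p] by simp
    then show "- 1 \<le> ((g s - c) /\<^sub>R r) \<bullet> ((p - c) /\<^sub>R r) \<and> ((g s - c) /\<^sub>R r) \<bullet> ((p - c) /\<^sub>R r) \<le> 1"
      unfolding abs_le_iff by linarith
  qed
qed

section \<open>Circular arcs and their lengths\<close>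

lemma norm_orthogonal_combination:
  fixes u w :: "'a::real_inner"
  assumes "norm u = r" "norm w = r" "u \<bullet> w = 0"
  shows "(norm (a *\<^sub>R u + b *\<^sub>R w))\<^sup>2 = r\<^sup>2 * (a\<^sup>2 + b\<^sup>2)"
proof -
  have "u \<bullet> u = r\<^sup>2" "w \<bullet> w = r\<^sup>2" "w \<bullet> u = 0"
    using assms by (auto simp: dot_square_norm inner_commute)
  then show ?thesis
    unfolding power2_norm_eq_inner
    by (simp add: inner_add_left inner_add_right assms(3) power2_eq_square algebra_simps)
qed

text \<open>The chord has length \<open>2 * r * \<bar>sin ((a - b) / 2)\<bar>\<close>, and
  \<open>\<bar>sin x\<bar> \<le> \<bar>x\<bar>\<close>.\<close>

lemma dist_circular_arc_le:
  fixes c u w :: "'a::real_inner"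
  assumes "norm u = r" "norm w = r" "u \<bullet> w = 0"
  shows "dist (c + cos a *\<^sub>R u + sin a *\<^sub>R w) (c + cos b *\<^sub>R u + sin b *\<^sub>R w) \<le> r * \<bar>a - b\<bar>"
proof -
  have half: "cos x = 1 - 2 * (sin (x / 2))\<^sup>2" for x :: real
    using cos_double_sin[of "x / 2"] by simp
  have "c + cos a *\<^sub>R u + sin a *\<^sub>R w - (c + cos b *\<^sub>R u + sin b *\<^sub>R w)
      = (cos a - cos b) *\<^sub>R u + (sin a - sin b) *\<^sub>R w"
    by (simp add: algebra_simps)
  then have "(dist (c + cos a *\<^sub>R u + sin a *\<^sub>R w) (c + cos b *\<^sub>R u + sin b *\<^sub>R w))\<^sup>2
      = r\<^sup>2 * ((cos a - cos b)\<^sup>2 + (sin a - sin b)\<^sup>2)"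
    by (simp add: dist_norm norm_orthogonal_combination[OF assms])
  also have "(cos a - cos b)\<^sup>2 + (sin a - sin b)\<^sup>2 = 2 - 2 * cos (a - b)"
    using sin_cos_squared_add[of a] sin_cos_squared_add[of b]
    by (simp add: power2_diff cos_diff algebra_simps)
  also have "\<dots> = (2 * sin ((a - b) / 2))\<^sup>2"
    by (simp add: half power_mult_distrib)
  also have "\<dots> \<le> (a - b)\<^sup>2"
    by (subst abs_le_square_iff[symmetric])
      (use abs_sin_x_le_abs_x[of "(a - b) / 2"] in \<open>simp add: abs_mult\<close>)
  finally have "(dist (c + cos a *\<^sub>R u + sin a *\<^sub>R w) (c + cos b *\<^sub>R u + sin b *\<^sub>R w))\<^sup>2 \<le> (r * \<bar>a - b\<bar>)\<^sup>2"
    by (simp add: power_mult_distrib mult_left_mono)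
  then show ?thesis
    by (rule power2_le_imp_le) (use assms(1) in auto)
qed

lemma circular_arc_path:
  fixes c u w :: "'a::real_inner"
  assumes "norm u = r" "norm w = r" "u \<bullet> w = 0"
    and X: "\<And>\<tau>. c + cos \<tau> *\<^sub>R u + sin \<tau> *\<^sub>R w \<in> X" and "a \<le> b"
  obtains g where "g \<in> paths_between X (c + cos a *\<^sub>R u + sin a *\<^sub>R w) (c + cos b *\<^sub>R u + sin b *\<^sub>R w)"
    "path_length g \<le> ennreal (r * (b - a))"
proof
  define g where "g s = c + cos (a + s * (b - a)) *\<^sub>R u + sin (a + s * (b - a)) *\<^sub>R w" for s
  show "g \<in> paths_between X (c + cos a *\<^sub>R u + sin a *\<^sub>R w) (c + cos b *\<^sub>R u + sin b *\<^sub>R w)"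
    using X by (auto simp: paths_between_def path_def path_image_def pathstart_def pathfinish_def g_def
        intro!: continuous_intros)
  show "path_length g \<le> ennreal (r * (b - a))"
  proof (rule path_length_Lipschitz)
    show "0 \<le> r * (b - a)" using assms(1,5) by auto
    fix s t :: real
    have "dist (g s) (g t) \<le> r * \<bar>(a + s * (b - a)) - (a + t * (b - a))\<bar>"
      unfolding g_def by (intro dist_circular_arc_le assms)
    also have "\<dots> = r * (b - a) * \<bar>s - t\<bar>"
      using assms(5) by (simp flip: left_diff_distrib add: abs_mult)
    finally show "dist (g s) (g t) \<le> r * (b - a) * \<bar>s - t\<bar>" .
  qed
qed

text \<open>Gram-Schmidt in the plane of the circle. The vector \<open>w\<close> depends on
  \<open>x\<close> and points to its side of the diameter through \<open>p\<close>, which is why an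
  angle between \<open>0\<close> and \<open>pi\<close> suffices.\<close>

lemma circle_coordinates:
  fixes c p x :: "'a::euclidean_space"
  assumes S: "is_circle c r S" and p: "p \<in> S" and x: "x \<in> S"
  obtains w \<theta> where "0 \<le> \<theta>" "\<theta> \<le> pi" "norm w = r" "(p - c) \<bullet> w = 0"
    "\<And>\<tau>. c + cos \<tau> *\<^sub>R (p - c) + sin \<tau> *\<^sub>R w \<in> S" "x = c + cos \<theta> *\<^sub>R (p - c) + sin \<theta> *\<^sub>R w"
proof -
  obtain P where P: "affine P" "aff_dim P = 2" "c \<in> P" "S = P \<inter> sphere c r" and r: "r > 0"
    using S by (auto simp: is_circle_def)
  define u v where "u = p - c" and "v = x - c"
  \<comment> \<open>Moving \<open>c\<close> to the origin turns the affine plane into a linear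
    one.\<close>
  define U where "U = (\<lambda>y. y - c) ` P"
  have U: "subspace U"
    unfolding U_def using P by (simp add: affine_diffs_subspace_subtract)
  have memU: "c + y \<in> P" if "y \<in> U" for y
    using that by (auto simp: U_def)
  have uv: "u \<in> U" "v \<in> U" "norm u = r" "norm v = r"
    using p x P by (auto simp: U_def u_def v_def dist_norm norm_minus_commute)
  have uu: "u \<bullet> u = r\<^sup>2" "v \<bullet> v = r\<^sup>2"
    using uv by (auto simp: dot_square_norm)
  have on_circle: "c + cos \<tau> *\<^sub>R u + sin \<tau> *\<^sub>R w \<in> S" if w: "w \<in> U" "norm w = r" "u \<bullet> w = 0" for w \<tau>
  proof -
    have "cos \<tau> *\<^sub>R u + sin \<tau> *\<^sub>R w \<in> U"
      using w uv U by (intro subspace_add subspace_scale)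
    moreover have "(norm (cos \<tau> *\<^sub>R u + sin \<tau> *\<^sub>R w))\<^sup>2 = r\<^sup>2"
      unfolding norm_orthogonal_combination[OF uv(3) w(2,3)] by simp
    then have "norm (cos \<tau> *\<^sub>R u + sin \<tau> *\<^sub>R w) = r"
      using r by (simp add: power2_eq_iff_nonneg)
    ultimately show ?thesis
      unfolding P(4) add.assoc using memU dist_norm[of "c + _" c] by (simp add: dist_commute[of c])
  qed
  define k where "k = (u \<bullet> v) / r\<^sup>2"
  have k: "\<bar>k\<bar> \<le> 1"
    using Cauchy_Schwarz_ineq2[of u v] uv r by (simp add: k_def power2_eq_square)
  define \<theta> where "\<theta> = arccos k"
  have \<theta>: "0 \<le> \<theta>" "\<theta> \<le> pi" "cos \<theta> = k" "sin \<theta> = sqrt (1 - k\<^sup>2)"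
    using k by (auto simp: \<theta>_def arccos_lbound arccos_ubound cos_arccos_abs sin_arccos_abs)
  have uvk: "v \<bullet> u = k * r\<^sup>2" "u \<bullet> v = k * r\<^sup>2"
    using r by (auto simp: k_def inner_commute)
  have perp: "u \<bullet> (v - k *\<^sub>R u) = 0"
    by (simp add: inner_diff_right uu uvk)
  have nrm2: "(norm (v - k *\<^sub>R u))\<^sup>2 = r\<^sup>2 * (1 - k\<^sup>2)"
    unfolding power2_norm_eq_inner inner_diff_left inner_diff_right inner_scaleR_left inner_scaleR_right uu uvk
    by (simp add: power2_eq_square[of k] right_diff_distrib)
  obtain w where w: "w \<in> U" "norm w = r" "u \<bullet> w = 0" "v = k *\<^sub>R u + sin \<theta> *\<^sub>R w"
  proof (cases "k\<^sup>2 = 1")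
    case False
    then have "k\<^sup>2 < 1" using k by (simp add: abs_square_less_1 abs_square_eq_1)
    then have s: "sin \<theta> > 0" "(sin \<theta>)\<^sup>2 = 1 - k\<^sup>2" using \<theta>(4) by auto
    have nrm: "norm (v - k *\<^sub>R u) = r * sin \<theta>"
      by (rule power2_eq_imp_eq) (use nrm2 r s in \<open>simp_all add: power_mult_distrib\<close>)
    show thesis
    proof (rule that[of "(v - k *\<^sub>R u) /\<^sub>R sin \<theta>"])
      show "(v - k *\<^sub>R u) /\<^sub>R sin \<theta> \<in> U"
        using uv U by (intro subspace_scale subspace_diff)
    qed (use s(1) nrm perp in simp_all)
  next
    \<comment> \<open>Here \<open>x - c\<close> is \<open>u\<close> or \<open>- u\<close> and
      singles out no direction. As \<open>U\<close> has dimension 2, it contains some vector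
      orthogonal to \<open>u\<close>; since \<open>sin \<theta> = 0\<close>, any such choice
      fits.\<close>
    case True
    have "dim U = 2"
      using aff_dim_eq_dim_subtract[OF hull_inc[OF P(3)]] P(2) by (simp add: U_def)
    have "span {u} \<subset> span U"
    proof -
      have "span {u} \<subseteq> span U" using uv by (intro span_mono) auto
      moreover have "span {u} \<noteq> span U"
        using \<open>dim U = 2\<close> dim_span[of U] dim_span[of "{u}"] dim_le_card'[of "{u}"] by fastforce
      ultimately show ?thesis by blast
    qed
    then obtain y where y: "y \<noteq> 0" "y \<in> span U" "\<And>z. z \<in> span {u} \<Longrightarrow> orthogonal y z"
      using orthogonal_to_subspace_exists_gen[of "{u}" U] by blast
    have "y \<in> U" using y(2) U by (simp add: span_eq_iff[THEN iffD2])
    have "y \<bullet> u = 0" using y(3)[of u] by (simp add: span_base orthogonal_def)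
    show thesis
    proof (rule that[of "(r / norm y) *\<^sub>R y"])
      show "v = k *\<^sub>R u + sin \<theta> *\<^sub>R (r / norm y) *\<^sub>R y"
        using nrm2 True \<theta>(4) by simp
    qed (use y(1) r \<open>y \<in> U\<close> \<open>y \<bullet> u = 0\<close> U in \<open>auto simp: subspace_scale inner_commute\<close>)
  qed
  show thesis
  proof (rule that[OF \<theta>(1,2) w(2)])
    show "(p - c) \<bullet> w = 0" using w(3) by (simp add: u_def)
    show "c + cos \<tau> *\<^sub>R (p - c) + sin \<tau> *\<^sub>R w \<in> S" for \<tau>
      using on_circle[OF w(1-3)] by (simp add: u_def)
    have "x = c + v" by (simp add: v_def)
    then show "x = c + cos \<theta> *\<^sub>R (p - c) + sin \<theta> *\<^sub>R w"
      using w(4) \<theta>(3) by (simp add: u_def add.assoc)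
  qed
qed

text \<open>The half circle from \<open>p\<close> through \<open>x\<close> ends at the antipode
  \<open>q\<close>; cutting it at the angle \<open>\<theta>\<close> of \<open>x\<close> leaves arcs
  of lengths \<open>r * \<theta>\<close> and \<open>r * (pi - \<theta>)\<close>.\<close>

lemma circle_half_paths:
  fixes c p q x :: "'a::euclidean_space"
  assumes S: "is_circle c r S" "p \<in> S" "x \<in> S" "S \<subseteq> X" and c: "midpoint p q = c"
  obtains l g h where "0 \<le> l" "l \<le> pi * r"
    "g \<in> paths_between X p x" "path_length g \<le> ennreal l"
    "h \<in> paths_between X x q" "path_length h \<le> ennreal (pi * r - l)"
proof -
  obtain w \<theta> where w: "0 \<le> \<theta>" "\<theta> \<le> pi" "norm w = r" "(p - c) \<bullet> w = 0"
    "\<And>\<tau>. c + cos \<tau> *\<^sub>R (p - c) + sin \<tau> *\<^sub>R w \<in> S" and x: "x = c + cos \<theta> *\<^sub>R (p - c) + sin \<theta> *\<^sub>R w"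
    using circle_coordinates[OF S(1-3)] by metis
  have u: "norm (p - c) = r" and r: "r > 0"
    using S(1,2) by (auto simp: is_circle_def dist_norm norm_minus_commute)
  have X: "c + cos \<tau> *\<^sub>R (p - c) + sin \<tau> *\<^sub>R w \<in> X" for \<tau>
    using w(5) S(4) by blast
  have q: "c + cos pi *\<^sub>R (p - c) + sin pi *\<^sub>R w = q"
    using c by (simp add: midpoint_eq_iff algebra_simps)
  obtain g where g: "g \<in> paths_between X p x" "path_length g \<le> ennreal (r * (\<theta> - 0))"
    using circular_arc_path[OF u w(3,4) X w(1)] x by auto
  obtain h where h: "h \<in> paths_between X x q" "path_length h \<le> ennreal (r * (pi - \<theta>))"
    using circular_arc_path[OF u w(3,4) X w(2)] x q by auto
  show thesis
    by (rule that[of "r * \<theta>" g h]) (use g h w(1,2) r in \<open>auto simp: algebra_simps\<close>)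
qed

section \<open>The mapping radius of two circles meeting in antipodal points\<close>

theorem lemma3:
  fixes S0 S1 :: "'e::euclidean_space set"
    and c0 c1 p q :: 'e
    and r0 r1 :: real
  assumes "is_circle c0 r0 S0" and "2 * pi * r0 = 4"
    and "is_circle c1 r1 S1" and "2 * pi * r1 = 4"
    and "S0 \<inter> S1 = {p, q}"
    and "midpoint p q = c0" and "midpoint p q = c1"
    and "\<exists>v :: 'v::real_normed_vector. v \<noteq> 0"
  shows "map_rad (arc_length_metric (S0 \<union> S1)) (euclidean_metric :: 'v metric) = 1"
proof -
  define X where "X = S0 \<union> S1"
  define c r where "c = c0" and "r = r0"
  \<comment> \<open>Equal circumferences and the common midpoint give both circles the same radius
    and centre, hence put them on one sphere.\<close>
  have "2 * pi * r1 = 2 * pi * r0" using assms(2,4) by (simp only:)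
  then have "r1 = r0" by simp
  then have eq: "c1 = c" "r1 = r" "c0 = c" "r0 = r" "midpoint p q = c"
    using assms by (auto simp: c_def r_def)
  have circ: "is_circle c r S0" "is_circle c r S1"
    using assms(1,3) eq by auto
  \<comment> \<open>A half circle has length 2.\<close>
  have r: "pi * r = 2" "r > 0"
    using assms(2) eq circ by (auto simp: is_circle_def)
  have pq: "p \<in> S0" "p \<in> S1" "q \<in> X"
    using assms(5) by (auto simp: X_def)
  then have "p \<in> X" by (simp add: X_def)
  have arcs: "\<exists>l g h. 0 \<le> l \<and> l \<le> 2 \<and> g \<in> paths_between X p x \<and> path_length g \<le> ennreal l \<and>
      h \<in> paths_between X x q \<and> path_length h \<le> ennreal (2 - l)" if "x \<in> X" for x
  proof -
    have "x \<in> S0 \<or> x \<in> S1" "S0 \<subseteq> X" "S1 \<subseteq> X"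
      using that by (auto simp: X_def)
    then obtain S where S: "is_circle c r S" "p \<in> S" "x \<in> S" "S \<subseteq> X"
      using circ pq(1,2) that by metis
    show ?thesis
      by (rule circle_half_paths[OF S eq(5)]) (unfold r(1), blast)
  qed
  \<comment> \<open>Any two points are joined by way of \<open>p\<close>.\<close>
  have rc: "rectifiably_connected X"
    unfolding rectifiably_connected_def
  proof (intro ballI)
    fix x y assume "x \<in> X" "y \<in> X"
    obtain g a where g: "g \<in> paths_between X p x" "path_length g \<le> ennreal a"
      using arcs[OF \<open>x \<in> X\<close>] by blast
    obtain h b where h: "h \<in> paths_between X p y" "path_length h \<le> ennreal b"
      using arcs[OF \<open>y \<in> X\<close>] by blast
    have "path_length (reversepath g +++ h) \<le> path_length (reversepath g) + path_length h"
      using g h by (intro path_length_join_le) (auto simp: paths_between_def)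
    also have "\<dots> \<le> ennreal a + ennreal b"
      using g h path_length_reversepath_le[of g] by (intro add_mono) auto
    also have "\<dots> < \<infinity>" by simp
    finally show "\<exists>g\<in>paths_between X x y. path_length g < \<infinity>"
      using join_in_paths_between[OF reversepath_in_paths_between[OF g(1)] h(1)] by blast
  qed
  interpret Metric_space X "arc_dist X"
    using rc by (rule Metric_space_arc_dist)
  have M: "mspace (arc_length_metric X) = X" "mdist (arc_length_metric X) = arc_dist X"
    by (simp_all add: arc_length_metric_def)
  have E: "mspace (euclidean_metric :: 'v metric) = UNIV" "mdist (euclidean_metric :: 'v metric) = dist"
    by simp_all
  have upper: "rad (euclidean_metric :: 'v metric) (f ` X) \<le> 1"
    if "f \<in> Metr (arc_length_metric X) euclidean_metric" for f
  proof -
    have f: "dist (f x) (f y) \<le> arc_dist X x y" if "x \<in> X" "y \<in> X" for x y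
      using \<open>f \<in> _\<close> that by (simp add: Metr_def M)
    have "dist (f x) (midpoint (f p) (f q)) \<le> 1" if x: "x \<in> X" for x
    proof -
      obtain l g h where l: "0 \<le> l" "l \<le> 2" "g \<in> paths_between X p x" "path_length g \<le> ennreal l"
        "h \<in> paths_between X x q" "path_length h \<le> ennreal (2 - l)"
        using arcs[OF x] by blast
      have "dist (f p) (f x) \<le> l" "dist (f x) (f q) \<le> 2 - l"
        using f[OF \<open>p \<in> X\<close> x] f[OF x \<open>q \<in> X\<close>] arc_dist_le[OF l(3,4)] arc_dist_le[OF l(5,6)] l(1,2)
        by auto
      then have *: "norm (f x - f p) + norm (f x - f q) \<le> 2"
        by (simp add: dist_norm norm_minus_commute)
      \<comment> \<open>The vector from the midpoint is the mean of the vectors from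
        \<open>f p\<close> and \<open>f q\<close>, whose norms add up to at most 2.\<close>
      have "f x - midpoint (f p) (f q) = (1/2) *\<^sub>R ((f x - f p) + (f x - f q))"
        by (simp add: midpoint_def algebra_simps flip: scaleR_add_left)
      then have "norm (f x - midpoint (f p) (f q)) = norm ((f x - f p) + (f x - f q)) / 2"
        by simp
      also have "\<dots> \<le> 1"
        using norm_triangle_ineq[of "f x - f p" "f x - f q"] * by linarith
      finally show ?thesis by (simp add: dist_norm)
    qed
    then show ?thesis
      unfolding rad_def E by (intro INF_lower2[of "midpoint (f p) (f q)"] SUP_least) auto
  qed
  obtain v :: 'v where v: "norm v = 1"
    using assms(8) by (metis norm_sgn)
  define h where "h x = arccos (((x - c) /\<^sub>R r) \<bullet> ((p - c) /\<^sub>R r))" for x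
  define f where "f x = (r * h x) *\<^sub>R v" for x
  have sph: "X \<subseteq> sphere c r"
    using circ by (auto simp: X_def is_circle_def)
  have "r * \<bar>h x - h y\<bar> \<le> arc_dist X x y" if xy: "x \<in> X" "y \<in> X" for x y
  proof (rule arc_dist_ge[OF rc xy])
    fix g assume "g \<in> paths_between X x y"
    then show "ennreal (r * \<bar>h x - h y\<bar>) \<le> path_length g"
      using angle_path_length[of g c r p] sph r \<open>p \<in> X\<close>
      unfolding h_def paths_between_def by blast
  qed
  moreover have "dist (f x) (f y) = r * \<bar>h x - h y\<bar>" for x y
    using r v by (simp add: f_def dist_norm abs_mult flip: scaleR_diff_left right_diff_distrib)
  ultimately have fM: "f \<in> Metr (arc_length_metric X) euclidean_metric"
    by (simp add: Metr_def M)
  have "norm (p - c) = r" and qc: "q - c = - (p - c)"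
    using sph \<open>p \<in> X\<close> eq(5)
    by (auto simp: dist_norm norm_minus_commute midpoint_eq_iff scaleR_2 algebra_simps)
  then have pp: "(p - c) \<bullet> (p - c) = r * r"
    by (simp only: dot_square_norm power2_eq_square)
  \<comment> \<open>The angles of \<open>p\<close> and \<open>q\<close> are
    \<open>arccos 1 = 0\<close> and \<open>arccos (- 1) = pi\<close>; the latter becomes 2 through
    \<open>pi * r = 2\<close>.\<close>
  have "((p - c) /\<^sub>R r) \<bullet> ((p - c) /\<^sub>R r) = 1" "((q - c) /\<^sub>R r) \<bullet> ((p - c) /\<^sub>R r) = - 1"
    unfolding qc inner_scaleR_left inner_scaleR_right inner_minus_left pp using r by (simp_all add: field_simps)
  then have fpq: "f p = 0" "f q = 2 *\<^sub>R v"
    using r by (auto simp: f_def h_def mult.commute)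
  have "1 \<le> (SUP a\<in>f ` X. ennreal (dist a y))" for y
  proof -
    have "dist (f p) (f q) = 2" using v by (simp add: fpq dist_norm)
    \<comment> \<open>Whatever the candidate centre \<open>y\<close>, its distances to
      \<open>f p\<close> and \<open>f q\<close> sum to at least 2.\<close>
    then have "1 \<le> dist (f p) y \<or> 1 \<le> dist (f q) y"
      using dist_triangle2[of "f p" "f q" y] by linarith
    then obtain a where "a \<in> X" "1 \<le> dist (f a) y"
      using \<open>p \<in> X\<close> \<open>q \<in> X\<close> by blast
    then show ?thesis
      by (intro SUP_upper2[of "f a"]) auto
  qed
  then have "1 \<le> rad (euclidean_metric :: 'v metric) (f ` X)"
    unfolding rad_def E by (intro INF_greatest)
  then have "1 \<le> map_rad (arc_length_metric X) (euclidean_metric :: 'v metric)"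
    unfolding map_rad_def M using fM by (rule SUP_upper2[rotated])
  moreover have "map_rad (arc_length_metric X) (euclidean_metric :: 'v metric) \<le> 1"
    unfolding map_rad_def M using upper by (rule SUP_least)
  ultimately show ?thesis
    by (simp add: X_def)
qed

end
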